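(* Let $k$ be a positive integer. The binomial transform $\{b_{k,n}\}_{n\ge 0}$ of the higher order Mersenne numbers satisfies $$b_{k,n+1}=(2+m_k)\,b_{k,n}-2m_k\,b_{k,n-1}, \quad n\geq 1,$$ with initial conditions $b_{k,0}=0$ and $b_{k,1}=1$, where $m_k$ is the $k$th Mersenne-Lucas number.
   Context: The Mersenne numbers $\{M_n\}_{n\ge 0}$ are defined by $M_0=0$, $M_1=1$, $M_{n+2}=3M_{n+1}-2M_n$, i.e. $M_n=2^n-1$. The Mersenne-Lucas numbers satisfy the same recurrence with $m_0=2$, $m_1=3$, i.e. $m_n=2^n+1$. For a positive integer $k$, the higher order Mersenne numbers are $M_n^{(k)}=M_{kn}/M_k$ for $n=0,1,2,\dots$, and their binomial transform is $b_{k,n}=\sum_{i=0}^{n}\binom{n}{i}M_i^{(k)}$ for $n\ge 0$. *)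

theory Defs
  imports Complex_Main
begin

fun mersenne :: "nat \<Rightarrow> int" where
  "mersenne 0 = 0"
| "mersenne (Suc 0) = 1"
| "mersenne (Suc (Suc n)) = 3 * mersenne (Suc n) - 2 * mersenne n"

fun mersenne_lucas :: "nat \<Rightarrow> int" where
  "mersenne_lucas 0 = 2"
| "mersenne_lucas (Suc 0) = 3"
| "mersenne_lucas (Suc (Suc n)) = 3 * mersenne_lucas (Suc n) - 2 * mersenne_lucas n"

text \<open>The division is taken in the rationals, so it is exact.  The definition is
  meaningful for \<open>k > 0\<close> only, since \<open>mersenne 0 = 0\<close>.\<close>

definition higher_mersenne :: "nat \<Rightarrow> nat \<Rightarrow> rat" where
  "higher_mersenne k n = of_int (mersenne (k * n)) / of_int (mersenne k)"

definition binomial_transform :: "(nat \<Rightarrow> rat) \<Rightarrow> nat \<Rightarrow> rat" where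
  "binomial_transform a n = (\<Sum>i=0..n. of_nat (n choose i) * a i)"

end

theory Submission imports Defs begin

text \<open>With \<open>M_n = 2^n - 1\<close>, the higher order numbers are a combination of the
  geometric sequences with ratios \<open>2^k\<close> and \<open>1\<close>. By the binomial theorem,
  the binomial transform raises each ratio by 1, to \<open>m_k = 2^k + 1\<close> and
  \<open>2\<close>. The resulting Binet formula (\<open>binomial_transform_higher_mersenne\<close>)
  gives the recurrence, whose characteristic roots are \<open>m_k\<close> and
  \<open>2\<close>.\<close>

lemma mersenne_eq: "mersenne n = 2 ^ n - 1"
  by (induction n rule: mersenne.induct) auto

lemma mersenne_lucas_eq: "mersenne_lucas n = 2 ^ n + 1"
  by (induction n rule: mersenne_lucas.induct) auto

lemma higher_mersenne_eq: "higher_mersenne k n = ((2 ^ k) ^ n - 1) / (2 ^ k - 1)"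
  by (simp add: higher_mersenne_def mersenne_eq power_mult)

lemma binomial_transform_higher_mersenne:
  "binomial_transform (higher_mersenne k) n
    = (of_int (mersenne_lucas k) ^ n - 2 ^ n) / (2 ^ k - 1)"
proof -
  have pow: "(\<Sum>i\<le>n. of_nat (n choose i) * x ^ i) = (x + 1) ^ n" for x :: rat
    by (simp add: binomial_ring)
  have "binomial_transform (higher_mersenne k) n
      = ((\<Sum>i\<le>n. of_nat (n choose i) * (2 ^ k) ^ i) - (\<Sum>i\<le>n. of_nat (n choose i) * 1 ^ i))
        / (2 ^ k - 1)"
    by (simp add: binomial_transform_def higher_mersenne_eq atLeast0AtMost
        sum_subtractf[symmetric] sum_divide_distrib right_diff_distrib)
  then show ?thesis
    by (simp only: pow) (simp add: mersenne_lucas_eq)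
qed

theorem theorem2p22:
  fixes k :: nat and b :: "nat \<Rightarrow> rat"
  defines "b \<equiv> binomial_transform (higher_mersenne k)"
  assumes "k > 0"
  shows "b 0 = 0 \<and> b 1 = 1 \<and>
    (\<forall>n\<ge>1. b (n + 1) =
      (2 + of_int (mersenne_lucas k)) * b n - 2 * of_int (mersenne_lucas k) * b (n - 1))"
proof (intro conjI allI impI)
  define m :: rat where "m = of_int (mersenne_lucas k)"
  have b: "b n = (m ^ n - 2 ^ n) / (2 ^ k - 1)" for n
    by (simp add: b_def m_def binomial_transform_higher_mersenne)
  show "b 0 = 0"
    by (simp add: b)
  \<comment> \<open>The denominator \<open>2 ^ k - 1\<close> is thus nonzero and cancels against
    \<open>m - 2\<close>.\<close>
  have "(2::rat) ^ k > 1"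
    using \<open>k > 0\<close> by (simp add: one_less_power)
  then show "b 1 = 1"
    by (simp add: b m_def mersenne_lucas_eq)
  fix n :: nat
  assume "n \<ge> 1"
  then obtain l where n: "n = Suc l"
    by (cases n) auto
  \<comment> \<open>Both \<open>m\<close> and \<open>2\<close> are roots of
    \<open>t^2 - (2 + m) * t + 2 * m\<close>, so their powers satisfy the recurrence. Writing
    \<open>n = Suc l\<close> removes the truncated subtraction in \<open>n - 1\<close>.\<close>
  have "m ^ (l + 2) - 2 ^ (l + 2)
      = (2 + m) * (m ^ (l + 1) - 2 ^ (l + 1)) - 2 * m * (m ^ l - 2 ^ l)"
    by (simp add: algebra_simps)
  then have "b (n + 1) = (2 + m) * b n - 2 * m * b (n - 1)"
    by (simp add: b n diff_divide_distrib[symmetric])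
  then show "b (n + 1) =
      (2 + of_int (mersenne_lucas k)) * b n - 2 * of_int (mersenne_lucas k) * b (n - 1)"
    by (simp add: m_def)
qed

end
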